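(* Let $N \ge 1$ and let $\underline{\mathbf{X}}, \underline{\mathbf{Y}} \in \mathbb{R}^{I_1 \times \cdots \times I_N}$ be real tensors of order $N$ given in the Tucker format $$\underline{\mathbf{X}} = \underline{\mathbf{G}}_x \times_1 \mathbf{A}_x^{(1)} \times_2 \mathbf{A}_x^{(2)} \cdots \times_N \mathbf{A}_x^{(N)}, \qquad \underline{\mathbf{Y}} = \underline{\mathbf{G}}_y \times_1 \mathbf{A}_y^{(1)} \times_2 \mathbf{A}_y^{(2)} \cdots \times_N \mathbf{A}_y^{(N)},$$ where $\underline{\mathbf{G}}_x \in \mathbb{R}^{Q_1 \times \cdots \times Q_N}$, $\underline{\mathbf{G}}_y \in \mathbb{R}^{P_1 \times \cdots \times P_N}$, $\mathbf{A}_x^{(n)} \in \mathbb{R}^{I_n \times Q_n}$ and $\mathbf{A}_y^{(n)} \in \mathbb{R}^{I_n \times P_n}$ for $n = 1, \dots, N$; the core dimensions $Q_n$ and $P_n$ are not required to be equal. Let $\mathbf{A}_z^{(n)} = \begin{bmatrix} \mathbf{A}_x^{(n)} & \mathbf{A}_y^{(n)} \end{bmatrix} \in \mathbb{R}^{I_n \times (Q_n + P_n)}$ for $n = 1, \dots, N$, and let $\underline{\mathbf{G}}_z \in \mathbb{R}^{(Q_1+P_1) \times \cdots \times (Q_N + P_N)}$ be the block tensor with $\underline{\mathbf{G}}_x$ and $\underline{\mathbf{G}}_y$ stacked along its superdiagonal and all other blocks zero. Then $$\underline{\mathbf{G}}_z \times_1 \mathbf{A}_z^{(1)} \times_2 \mathbf{A}_z^{(2)}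 \cdots \times_N \mathbf{A}_z^{(N)} = \underline{\mathbf{X}} + \underline{\mathbf{Y}}.$$
   Context: All tensors are real arrays and all dimensions are positive integers. For a tensor $\underline{\mathbf{G}} \in \mathbb{R}^{Q_1 \times \cdots \times Q_N}$ and a matrix $\mathbf{A} \in \mathbb{R}^{I \times Q_n}$, the mode-$n$ contraction $\underline{\mathbf{G}} \times_n \mathbf{A}$ is the tensor of size $Q_1 \times \cdots \times Q_{n-1} \times I \times Q_{n+1} \times \cdots \times Q_N$ with entries $$(\underline{\mathbf{G}} \times_n \mathbf{A})(q_1, \dots, q_{n-1}, i, q_{n+1}, \dots, q_N) = \sum_{q_n = 1}^{Q_n} \underline{\mathbf{G}}(q_1, \dots, q_N)\, \mathbf{A}(i, q_n).$$ Thus $\underline{\mathbf{X}} = \underline{\mathbf{G}} \times_1 \mathbf{A}^{(1)} \cdots \times_N \mathbf{A}^{(N)}$ means $$\underline{\mathbf{X}}(i_1, \dots, i_N) = \sum_{q_1, \dots, q_N} \underline{\mathbf{G}}(q_1, \dots, q_N) \prod_{n=1}^N \mathbf{A}^{(n)}(i_n, q_n).$$ A tensor is in the Tucker format if it is written in this form with some core $\underline{\mathbf{G}}$ and some factor matrices $\mathbf{A}^{(n)}$; no orthogonality or rank condition is imposed on them. The superdiagonal block tensor $\underline{\mathbf{G}}_z$ built from $\underline{\mathbf{G}}_x \in \mathbb{R}^{Q_1 \times \cdots \times Q_N}$ and $\underline{\mathbf{G}}_y \in \mathbb{R}^{P_1 \times \cdots \times P_N}$ has entries: $\underline{\mathbf{G}}_z(k_1,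 \dots, k_N) = \underline{\mathbf{G}}_x(k_1, \dots, k_N)$ if $k_n \le Q_n$ for all $n$; $\underline{\mathbf{G}}_z(k_1, \dots, k_N) = \underline{\mathbf{G}}_y(k_1 - Q_1, \dots, k_N - Q_N)$ if $k_n > Q_n$ for all $n$; and $\underline{\mathbf{G}}_z(k_1, \dots, k_N) = 0$ otherwise. *)

theory Defs
  imports "Jordan_Normal_Form.Matrix" "HOL-Library.FuncSet"
begin

text \<open>
  A tensor is a list of dimensions (one per mode) together with its entries. Modes and indices are
  counted from 0, as for matrices in \<^theory>\<open>Jordan_Normal_Form.Matrix\<close>. Entries outside the index
  range are fixed to \<^const>\<open>undefined\<close>, so that equality of tensors means equal dimensions and equal
  entries at every valid multi-index.
\<close>

definition tensor_index :: "nat list \<Rightarrow> nat list set" where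
  "tensor_index ds = {ks. length ks = length ds \<and> (\<forall>n < length ds. ks ! n < ds ! n)}"

typedef 'a tensor = "{(ds, f :: nat list \<Rightarrow> 'a). f \<in> extensional (tensor_index ds)}"
  by (rule exI[of _ "([], restrict undefined (tensor_index []))"]) simp

setup_lifting type_definition_tensor

lift_definition tensor :: "nat list \<Rightarrow> (nat list \<Rightarrow> 'a) \<Rightarrow> 'a tensor"
  is "\<lambda>ds f. (ds, restrict f (tensor_index ds))"
  by simp

lift_definition dims :: "'a tensor \<Rightarrow> nat list" is fst .

lift_definition entry :: "'a tensor \<Rightarrow> nat list \<Rightarrow> 'a" is snd .

definition carrier_tensor :: "nat list \<Rightarrow> 'a tensor set" where
  "carrier_tensor ds = {T. dims T = ds}"

lemma dims_tensor [simp]: "dims (tensor ds f) = ds"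
  by transfer simp

lemma entry_tensor [simp]: "ks \<in> tensor_index ds \<Longrightarrow> entry (tensor ds f) ks = f ks"
  by transfer simp

lemma tensor_eqI:
  assumes "dims S = dims T" and "\<And>ks. ks \<in> tensor_index (dims T) \<Longrightarrow> entry S ks = entry T ks"
  shows "S = T"
  using assms by transfer (auto intro: extensionalityI)

text \<open>
  As for matrices, the sum is total; it is meaningful only if both tensors have the same dimensions.
\<close>

instantiation tensor :: (plus) plus
begin

definition plus_tensor :: "'a tensor \<Rightarrow> 'a tensor \<Rightarrow> 'a tensor" where
  "S + T = tensor (dims T) (\<lambda>ks. entry S ks + entry T ks)"

instance ..

end

definition mode_contract :: "'a :: semiring_0 tensor \<Rightarrow> nat \<Rightarrow> 'a mat \<Rightarrow> 'a tensor" where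
  "mode_contract G n A =
     tensor ((dims G)[n := dim_row A])
       (\<lambda>ks. \<Sum>q < dims G ! n. entry G (ks[n := q]) * A $$ (ks ! n, q))"

text \<open>
  The contractions are applied from left to right, in modes \<open>0, \<dots>, N - 1\<close>, where \<open>N\<close> is the order
  of the core \<open>G\<close>.
\<close>

definition tucker :: "'a :: semiring_0 tensor \<Rightarrow> (nat \<Rightarrow> 'a mat) \<Rightarrow> 'a tensor" where
  "tucker G A = fold (\<lambda>n T. mode_contract T n (A n)) [0..<length (dims G)] G"

definition superdiag_block :: "'a :: zero tensor \<Rightarrow> 'a tensor \<Rightarrow> 'a tensor" where
  "superdiag_block G H =
     tensor (map2 (+) (dims G) (dims H))
       (\<lambda>ks. if \<forall>n < length (dims G). ks ! n < dims G ! n then entry G ks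
             else if \<forall>n < length (dims G). dims G ! n \<le> ks ! n then entry H (map2 (-) ks (dims G))
             else 0)"

text \<open>
  The block matrix \<open>[A B]\<close>, the column counterpart of \<^const>\<open>append_rows\<close>; the two lower blocks
  have no rows.
\<close>

definition append_cols :: "'a :: zero mat \<Rightarrow> 'a mat \<Rightarrow> 'a mat" where
  "append_cols A B = four_block_mat A B (0\<^sub>m 0 (dim_col A)) (0\<^sub>m 0 (dim_col B))"

end

theory Submission
  imports Defs
begin

text \<open>
  Compare the partial contractions in modes \<open>0, \<dots>, m - 1\<close>. After them, the tensor built from the
  block core is still superdiagonal with respect to the modes \<open>m, \<dots>, N - 1\<close>, its two diagonal blocks
  being the partial contractions of the two cores. Contracting mode \<open>m\<close> preserves this, since the
  sum over that mode splits at the boundary between the columns of the two factor matrices. Once no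
  mode is left, both blocks occupy the whole index range, and hence add up.
\<close>

definition contract_upto :: "nat \<Rightarrow> 'a :: semiring_0 tensor \<Rightarrow> (nat \<Rightarrow> 'a mat) \<Rightarrow> 'a tensor" where
  "contract_upto m G A = fold (\<lambda>n T. mode_contract T n (A n)) [0..<m] G"

lemma contract_upto_0 [simp]: "contract_upto 0 G A = G"
  by (simp add: contract_upto_def)

lemma contract_upto_Suc:
  "contract_upto (Suc m) G A = mode_contract (contract_upto m G A) m (A m)"
  by (simp add: contract_upto_def)

lemma tucker_eq_contract_upto: "tucker G A = contract_upto (length (dims G)) G A"
  by (simp add: tucker_def contract_upto_def)

lemma dims_mode_contract [simp]: "dims (mode_contract G n A) = (dims G)[n := dim_row A]"
  by (simp add: mode_contract_def)

lemma length_dims_contract_upto [simp]: "length (dims (contract_upto m G A)) = length (dims G)"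
  by (induction m) (simp_all add: contract_upto_Suc)

lemma nth_dims_contract_upto:
  assumes "n < length (dims G)"
  shows "dims (contract_upto m G A) ! n = (if n < m then dim_row (A n) else dims G ! n)"
  using assms by (induction m) (auto simp: contract_upto_Suc nth_list_update less_Suc_eq)

text \<open>The first \<open>m\<close> contractions leave mode \<open>m\<close> untouched, so the
  sum still runs over the dimension of the original core.\<close>

lemma entry_contract_upto_Suc:
  assumes "m < length (dims G)"
    and "ks \<in> tensor_index (dims (contract_upto (Suc m) G A))"
  shows "entry (contract_upto (Suc m) G A) ks =
    (\<Sum>q < dims G ! m. entry (contract_upto m G A) (ks[m := q]) * A m $$ (ks ! m, q))"
  using assms by (simp add: contract_upto_Suc mode_contract_def nth_dims_contract_upto)

lemma dim_row_append_cols [simp]: "dim_row (append_cols A B) = dim_row A"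
  by (simp add: append_cols_def)

lemma index_append_cols:
  assumes "i < dim_row A" and "j < dim_col A + dim_col B"
  shows "append_cols A B $$ (i, j) = (if j < dim_col A then A $$ (i, j) else B $$ (i, j - dim_col A))"
  using assms by (simp add: append_cols_def)

lemma sum_lessThan_add_nat:
  fixes f :: "nat \<Rightarrow> 'a :: comm_monoid_add"
  shows "(\<Sum>q < m + n. f q) = (\<Sum>q < m. f q) + (\<Sum>q < n. f (m + q))"
  by (induction n) (simp_all add: add.assoc)

lemma dims_superdiag_block [simp]:
  "dims (superdiag_block G H) = map2 (+) (dims G) (dims H)"
  by (simp add: superdiag_block_def)

text \<open>
  The multi-index in the second block: the modes below \<open>m\<close> are already contracted and carry no offset.
\<close>

definition shift_from :: "nat \<Rightarrow> nat list \<Rightarrow> nat list \<Rightarrow> nat list" where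
  "shift_from m ds ks = map (\<lambda>n. if n < m then ks ! n else ks ! n - ds ! n) [0..<length ks]"

lemma length_shift_from [simp]: "length (shift_from m ds ks) = length ks"
  by (simp add: shift_from_def)

lemma shift_from_0:
  assumes "length ks = length ds"
  shows "shift_from 0 ds ks = map2 (-) ks ds"
  using assms by (auto simp: shift_from_def intro!: nth_equalityI)

lemma shift_from_length [simp]: "shift_from (length ks) ds ks = ks"
  by (rule nth_equalityI) (simp_all add: shift_from_def)

text \<open>The offset inserted at mode \<open>m\<close> cancels the subtraction there. This turns a
  summation index beyond the block boundary into one local to the second core.\<close>

lemma shift_from_update:
  assumes "m < length ks"
  shows "shift_from m ds (ks[m := ds ! m + q]) = (shift_from (Suc m) ds ks)[m := q]"
  using assms
  by (auto simp: shift_from_def nth_list_update less_Suc_eq intro!: nth_equalityI)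

lemma nth_shift_from:
  assumes "n < length ks"
  shows "shift_from m ds ks ! n = (if n < m then ks ! n else ks ! n - ds ! n)"
  using assms by (simp add: shift_from_def)

text \<open>The invariant for induction on \<open>m\<close>. Its conditions test only the
  uncontracted modes: they exclude each other while such modes remain and both hold vacuously at the
  end. Hence a sum of two conditionals, unlike the nested one in
  \<open>superdiag_block\<close>.\<close>

lemma entry_contract_upto_superdiag_block:
  fixes G H :: "'a :: semiring_0 tensor"
  assumes len: "length (dims H) = length (dims G)" and pos: "length (dims G) > 0"
    and row: "\<And>n. n < length (dims G) \<Longrightarrow> dim_row (B n) = dim_row (A n)"
    and colA: "\<And>n. n < length (dims G) \<Longrightarrow> dim_col (A n) = dims G ! n"
    and colB: "\<And>n. n < length (dims G) \<Longrightarrow> dim_col (B n) = dims H ! n"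
    and C: "\<And>n. n < length (dims G) \<Longrightarrow> C n = append_cols (A n) (B n)"
    and m: "m \<le> length (dims G)"
    and ks: "ks \<in> tensor_index (dims (contract_upto m (superdiag_block G H) C))"
  shows "entry (contract_upto m (superdiag_block G H) C) ks =
    (if \<forall>n \<in> {m..<length (dims G)}. ks ! n < dims G ! n
     then entry (contract_upto m G A) ks else 0) +
    (if \<forall>n \<in> {m..<length (dims G)}. dims G ! n \<le> ks ! n
     then entry (contract_upto m H B) (shift_from m (dims G) ks) else 0)"
  using m ks
proof (induction m arbitrary: ks)
  case 0
  then have "length ks = length (dims G)"
    using len by (simp add: tensor_index_def)
  \<comment> \<open>With at least one mode, no index lies in both blocks, so the nested conditional
    of the block core equals the sum of two.\<close>
  moreover have "\<not> ((\<forall>n < length (dims G). ks ! n < dims G ! n) \<and>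
      (\<forall>n < length (dims G). dims G ! n \<le> ks ! n))"
    using pos by (meson not_le)
  ultimately show ?case
    using "0.prems" by (auto simp: superdiag_block_def shift_from_0)
next
  case (Suc m)
  let ?N = "length (dims G)" and ?Q = "dims G" and ?P = "dims H"
  let ?Z = "superdiag_block G H"
  have mN: "m < ?N" using Suc.prems by simp
  have lenZ: "length (dims ?Z) = ?N" using len by simp
  have dimZ: "dims (contract_upto k ?Z C) ! n =
      (if n < k then dim_row (A n) else ?Q ! n + ?P ! n)" if "n < ?N" for n k
    using that len by (simp add: nth_dims_contract_upto C)
  have lks: "length ks = ?N"
    and ks: "\<And>n. n < ?N \<Longrightarrow> ks ! n < (if n < Suc m then dim_row (A n) else ?Q ! n + ?P ! n)"
    using Suc.prems lenZ dimZ by (auto simp: tensor_index_def)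
  have km: "ks ! m < dim_row (A m)" using ks[OF mN] by simp
  \<comment> \<open>\<open>a\<close> and \<open>b\<close> are the block conditions after contracting
    mode \<open>m\<close>. They do not involve the summation index \<open>q\<close>, which alone
    decides the test in mode \<open>m\<close>.\<close>
  define a where "a \<longleftrightarrow> (\<forall>n \<in> {Suc m..<?N}. ks ! n < ?Q ! n)"
  define b where "b \<longleftrightarrow> (\<forall>n \<in> {Suc m..<?N}. ?Q ! n \<le> ks ! n)"
  have split: "{m..<?N} = insert m {Suc m..<?N}" using mN by auto
  have upd: "ks[m := q] \<in> tensor_index (dims (contract_upto m ?Z C))"
    if "q < ?Q ! m + ?P ! m" for q
  proof -
    have "ks[m := q] ! n < dims (contract_upto m ?Z C) ! n" if "n < ?N" for n
      using ks[OF that] \<open>q < _\<close> that lks mN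
      by (cases n m rule: linorder_cases) (simp_all add: dimZ)
    then show ?thesis using lks lenZ by (simp add: tensor_index_def)
  qed
  \<comment> \<open>For \<open>q\<close> below the boundary the second summand of the induction
    hypothesis vanishes, as its test fails at mode \<open>m\<close>; \<open>high\<close> is the
    mirror case.\<close>
  have low: "entry (contract_upto m ?Z C) (ks[m := q]) * C m $$ (ks ! m, q) =
      (if a then entry (contract_upto m G A) (ks[m := q]) * A m $$ (ks ! m, q) else 0)"
    if q: "q < ?Q ! m" for q
  proof -
    have "entry (contract_upto m ?Z C) (ks[m := q]) =
        (if a then entry (contract_upto m G A) (ks[m := q]) else 0)"
      using Suc.IH[OF _ upd[of q]] mN q lks by (simp add: split a_def)
    moreover have "C m $$ (ks ! m, q) = A m $$ (ks ! m, q)"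
      using q km mN by (simp add: C index_append_cols colA colB)
    ultimately show ?thesis by simp
  qed
  have high: "entry (contract_upto m ?Z C) (ks[m := ?Q ! m + q]) * C m $$ (ks ! m, ?Q ! m + q) =
      (if b then entry (contract_upto m H B) ((shift_from (Suc m) ?Q ks)[m := q]) *
         B m $$ (ks ! m, q) else 0)"
    if q: "q < ?P ! m" for q
  proof -
    have "entry (contract_upto m ?Z C) (ks[m := ?Q ! m + q]) =
        (if b then entry (contract_upto m H B) ((shift_from (Suc m) ?Q ks)[m := q]) else 0)"
      using Suc.IH[OF _ upd[of "?Q ! m + q"]] mN q lks
      by (simp add: split b_def shift_from_update)
    moreover have "C m $$ (ks ! m, ?Q ! m + q) = B m $$ (ks ! m, q)"
      using q km mN by (simp add: C index_append_cols colA colB)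
    ultimately show ?thesis by simp
  qed
  \<comment> \<open>Without \<open>a\<close>, the index \<open>ks\<close> may leave the range of the
    contracted first core, where entries are \<open>undefined\<close>.\<close>
  have G: "entry (contract_upto (Suc m) G A) ks =
      (\<Sum>q < ?Q ! m. entry (contract_upto m G A) (ks[m := q]) * A m $$ (ks ! m, q))" if a
  proof (rule entry_contract_upto_Suc[OF mN])
    have "ks ! n < dims (contract_upto (Suc m) G A) ! n" if "n < ?N" for n
      using ks[OF that] \<open>a\<close> that by (auto simp: nth_dims_contract_upto a_def)
    then show "ks \<in> tensor_index (dims (contract_upto (Suc m) G A))"
      using lks by (simp add: tensor_index_def)
  qed
  \<comment> \<open>Here \<open>b\<close> makes the subtraction exact, so the bound
    \<open>?Q ! n + ?P ! n\<close> becomes \<open>?P ! n\<close>.\<close>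
  have H: "entry (contract_upto (Suc m) H B) (shift_from (Suc m) ?Q ks) =
      (\<Sum>q < ?P ! m. entry (contract_upto m H B) ((shift_from (Suc m) ?Q ks)[m := q]) *
         B m $$ (ks ! m, q))" if b
  proof -
    have "shift_from (Suc m) ?Q ks ! n < dims (contract_upto (Suc m) H B) ! n" if "n < ?N" for n
      using ks[OF that] \<open>b\<close> that lks len
      by (cases "n < Suc m")
        (simp_all add: nth_dims_contract_upto nth_shift_from row b_def less_diff_conv2 add.commute)
    then have "shift_from (Suc m) ?Q ks \<in> tensor_index (dims (contract_upto (Suc m) H B))"
      using lks len by (simp add: tensor_index_def)
    then show ?thesis
      using entry_contract_upto_Suc[of m H] mN len lks by (simp add: nth_shift_from)
  qed
  have "entry (contract_upto (Suc m) ?Z C) ks =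
      (\<Sum>q < ?Q ! m + ?P ! m. entry (contract_upto m ?Z C) (ks[m := q]) * C m $$ (ks ! m, q))"
    using entry_contract_upto_Suc[of m ?Z ks C] Suc.prems lenZ mN len by simp
  also have "\<dots> = (if a then entry (contract_upto (Suc m) G A) ks else 0) +
      (if b then entry (contract_upto (Suc m) H B) (shift_from (Suc m) ?Q ks) else 0)"
    \<comment> \<open>The sum is cut at \<open>?Q ! m\<close>, and the constant conditions
      \<open>a\<close> and \<open>b\<close> come out of the two parts.\<close>
    by (simp add: sum_lessThan_add_nat low high G H)
  finally show ?case by (simp add: a_def b_def)
qed

theorem tucker_superdiag_block:
  fixes G H :: "'a :: semiring_0 tensor"
  assumes "length (dims H) = length (dims G)" and "length (dims G) > 0"
    and "\<And>n. n < length (dims G) \<Longrightarrow> dim_row (B n) = dim_row (A n)"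
    and "\<And>n. n < length (dims G) \<Longrightarrow> dim_col (A n) = dims G ! n"
    and "\<And>n. n < length (dims G) \<Longrightarrow> dim_col (B n) = dims H ! n"
    and "\<And>n. n < length (dims G) \<Longrightarrow> C n = append_cols (A n) (B n)"
  shows "tucker (superdiag_block G H) C = tucker G A + tucker H B"
proof (rule tensor_eqI)
  let ?N = "length (dims G)" and ?Z = "superdiag_block G H"
  \<comment> \<open>Addition takes its dimensions from the second summand, hence the comparison with
    \<open>H\<close> and \<open>B\<close>.\<close>
  have "dims (contract_upto ?N ?Z C) = dims (contract_upto ?N H B)"
    using assms by (intro nth_equalityI) (simp_all add: nth_dims_contract_upto)
  then show dims_eq: "dims (tucker ?Z C) = dims (tucker G A + tucker H B)"
    using assms(1) by (simp add: plus_tensor_def tucker_eq_contract_upto)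
  fix ks assume ks: "ks \<in> tensor_index (dims (tucker G A + tucker H B))"
  then have len: "length ks = ?N"
    using assms(1) by (simp add: plus_tensor_def tensor_index_def tucker_eq_contract_upto)
  have "ks \<in> tensor_index (dims (contract_upto ?N ?Z C))"
    using ks assms(1) unfolding dims_eq[symmetric] by (simp add: tucker_eq_contract_upto)
  \<comment> \<open>With all modes contracted, both conditions range over an empty set and the shift
    is the identity.\<close>
  from entry_contract_upto_superdiag_block[OF assms order.refl this]
  show "entry (tucker ?Z C) ks = entry (tucker G A + tucker H B) ks"
    using ks assms(1) shift_from_length[of ks "dims G"]
    by (simp add: plus_tensor_def tucker_eq_contract_upto len)
qed

theorem proposition2:
  fixes N :: nat
    and I Q P :: "nat list"
    and X Y Gx Gy Gz :: "real tensor"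
    and Ax Ay Az :: "nat \<Rightarrow> real mat"
  assumes "N \<ge> 1"
    and "length I = N" and "length Q = N" and "length P = N"
    and "\<And>n. n < N \<Longrightarrow> I ! n > 0" and "\<And>n. n < N \<Longrightarrow> Q ! n > 0" and "\<And>n. n < N \<Longrightarrow> P ! n > 0"
    and "X \<in> carrier_tensor I" and "Y \<in> carrier_tensor I"
    and "Gx \<in> carrier_tensor Q" and "Gy \<in> carrier_tensor P"
    and "\<And>n. n < N \<Longrightarrow> Ax n \<in> carrier_mat (I ! n) (Q ! n)"
    and "\<And>n. n < N \<Longrightarrow> Ay n \<in> carrier_mat (I ! n) (P ! n)"
    and "X = tucker Gx Ax" and "Y = tucker Gy Ay"
    and "\<And>n. n < N \<Longrightarrow> Az n = append_cols (Ax n) (Ay n)"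
    and "Gz = superdiag_block Gx Gy"
  shows "tucker Gz Az = X + Y"
proof -
  have "dims Gx = Q" "dims Gy = P"
    using assms(10,11) by (simp_all add: carrier_tensor_def)
  then show ?thesis
    unfolding assms(14,15,17)
    using assms(1,3,4) carrier_matD[OF assms(12)] carrier_matD[OF assms(13)] assms(16)
    by (intro tucker_superdiag_block) simp_all
qed

end
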